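(* Let $n\ge 1$ be an integer, let $\mu=\mu_{1/(2n)}$ be the Bernoulli convolution measure with scale factor $\frac{1}{2n}$, and suppose that the canonical family $E(\Gamma)=\{e_\gamma:\gamma\in\Gamma\}$ is an orthonormal basis of $L^2(\mu)$. Let $S_0,S_1$ be the bounded linear operators on $L^2(\mu)$ determined by $S_0e_\gamma=e_{2n\gamma}$ and $S_1e_\gamma=e_{\frac n2+2n\gamma}$ for all $\gamma\in\Gamma$. Then $S_0,S_1$ satisfy the Cuntz relations: (1) $S_0S_0^*+S_1S_1^*=I$, and (2) $S_i^*S_j=\delta_{i,j}I$ for $i,j\in\{0,1\}$.
   Context: For $\lambda\in(0,1)$, $\mu_\lambda$ is the unique Borel probability measure on $\mathbb{R}$ satisfying $\mu_\lambda=\frac12\mu_\lambda\circ\tau_+^{-1}+\frac12\mu_\lambda\circ\tau_-^{-1}$, where $\tau_\pm(x)=\lambda(x\pm1)$; it is compactly supported. Here $\lambda=\frac1{2n}$ and $\mu=\mu_{1/(2n)}$. For $t\in\mathbb{R}$, $e_t(x)=e^{2\pi i t x}$, regarded as an element of $L^2(\mu)$. The canonical index set is $\Gamma=\{\sum_{i=0}^m a_i(2n)^i: m\ge0,\ a_i\in\{0,\frac n2\}\}$. It satisfies $\Gamma=2n\Gamma\sqcup(\frac n2+2n\Gamma)$. *)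

theory Defs
  imports "HOL-Probability.Probability"
begin

text \<open>
  The complex Hilbert space \<open>L\<^sup>2(M)\<close> depends on the measure \<open>M\<close>, so it is modelled by
  a carrier set \<open>L2 M\<close> whose elements are classes of square-integrable functions modulo
  equality almost everywhere.
\<close>

definition L2_funs :: "'a measure \<Rightarrow> ('a \<Rightarrow> complex) set" where
  "L2_funs M = {f \<in> borel_measurable M. integrable M (\<lambda>x. (cmod (f x))\<^sup>2)}"

definition L2_class :: "'a measure \<Rightarrow> ('a \<Rightarrow> complex) \<Rightarrow> ('a \<Rightarrow> complex) set" where
  "L2_class M f = {g \<in> L2_funs M. AE x in M. g x = f x}"

definition L2 :: "'a measure \<Rightarrow> ('a \<Rightarrow> complex) set set" where
  "L2 M = L2_class M ` L2_funs M"

text \<open>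
  The operations are computed on chosen representatives; the results do not depend on the choice
  (lemmas \<open>L2_add_class\<close>, \<open>L2_scale_class\<close> and \<open>L2_inner_class\<close> below).
\<close>

definition L2_rep :: "('a \<Rightarrow> complex) set \<Rightarrow> 'a \<Rightarrow> complex" where
  "L2_rep F = (SOME f. f \<in> F)"

definition L2_zero :: "'a measure \<Rightarrow> ('a \<Rightarrow> complex) set" where
  "L2_zero M = L2_class M (\<lambda>x. 0)"

definition L2_add ::
  "'a measure \<Rightarrow> ('a \<Rightarrow> complex) set \<Rightarrow> ('a \<Rightarrow> complex) set \<Rightarrow> ('a \<Rightarrow> complex) set" where
  "L2_add M F G = L2_class M (\<lambda>x. L2_rep F x + L2_rep G x)"

definition L2_scale ::
  "'a measure \<Rightarrow> complex \<Rightarrow> ('a \<Rightarrow> complex) set \<Rightarrow> ('a \<Rightarrow> complex) set" where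
  "L2_scale M c F = L2_class M (\<lambda>x. c * L2_rep F x)"

definition L2_inner ::
  "'a measure \<Rightarrow> ('a \<Rightarrow> complex) set \<Rightarrow> ('a \<Rightarrow> complex) set \<Rightarrow> complex" where
  "L2_inner M F G = (LINT x|M. L2_rep F x * cnj (L2_rep G x))"

definition L2_norm :: "'a measure \<Rightarrow> ('a \<Rightarrow> complex) set \<Rightarrow> real" where
  "L2_norm M F = sqrt (LINT x|M. (cmod (L2_rep F x))\<^sup>2)"

definition L2_dist ::
  "'a measure \<Rightarrow> ('a \<Rightarrow> complex) set \<Rightarrow> ('a \<Rightarrow> complex) set \<Rightarrow> real" where
  "L2_dist M F G = L2_norm M (L2_add M F (L2_scale M (-1) G))"

definition L2_subspace :: "'a measure \<Rightarrow> ('a \<Rightarrow> complex) set set \<Rightarrow> bool" where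
  "L2_subspace M V \<longleftrightarrow> V \<subseteq> L2 M \<and> L2_zero M \<in> V \<and>
     (\<forall>F\<in>V. \<forall>G\<in>V. L2_add M F G \<in> V) \<and> (\<forall>c. \<forall>F\<in>V. L2_scale M c F \<in> V)"

definition L2_orthonormal_basis ::
  "'a measure \<Rightarrow> 'i set \<Rightarrow> ('i \<Rightarrow> ('a \<Rightarrow> complex) set) \<Rightarrow> bool" where
  "L2_orthonormal_basis M I E \<longleftrightarrow>
     (\<forall>i\<in>I. E i \<in> L2 M) \<and>
     (\<forall>i\<in>I. \<forall>j\<in>I. L2_inner M (E i) (E j) = (if i = j then 1 else 0)) \<and>
     (\<forall>F\<in>L2 M. \<forall>\<epsilon>>0. \<exists>G \<in> L2_subspace M hull (E ` I). L2_dist M F G < \<epsilon>)"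

definition L2_bounded_linear ::
  "'a measure \<Rightarrow> (('a \<Rightarrow> complex) set \<Rightarrow> ('a \<Rightarrow> complex) set) \<Rightarrow> bool" where
  "L2_bounded_linear M T \<longleftrightarrow>
     (\<forall>F\<in>L2 M. T F \<in> L2 M) \<and>
     (\<forall>F\<in>L2 M. \<forall>G\<in>L2 M. T (L2_add M F G) = L2_add M (T F) (T G)) \<and>
     (\<forall>c. \<forall>F\<in>L2 M. T (L2_scale M c F) = L2_scale M c (T F)) \<and>
     (\<exists>K. \<forall>F\<in>L2 M. L2_norm M (T F) \<le> K * L2_norm M F)"

text \<open>
  For a bounded linear \<open>T\<close> and \<open>G \<in> L2 M\<close>, the vector \<open>T\<^sup>* G\<close> exists and is unique by the
  Riesz representation theorem.
\<close>

definition L2_adjoint ::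
  "'a measure \<Rightarrow> (('a \<Rightarrow> complex) set \<Rightarrow> ('a \<Rightarrow> complex) set) \<Rightarrow>
    ('a \<Rightarrow> complex) set \<Rightarrow> ('a \<Rightarrow> complex) set" where
  "L2_adjoint M T G =
     (THE H. H \<in> L2 M \<and> (\<forall>F\<in>L2 M. L2_inner M (T F) G = L2_inner M F H))"

definition bernoulli_convolution :: "real \<Rightarrow> real measure \<Rightarrow> bool" where
  "bernoulli_convolution l \<mu> \<longleftrightarrow> sets \<mu> = sets borel \<and> prob_space \<mu> \<and>
     (\<forall>A\<in>sets borel. measure \<mu> A =
        1/2 * measure (distr \<mu> borel (\<lambda>x. l * (x + 1))) A +
        1/2 * measure (distr \<mu> borel (\<lambda>x. l * (x - 1))) A)"

definition expo :: "real measure \<Rightarrow> real \<Rightarrow> (real \<Rightarrow> complex) set" where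
  "expo \<mu> t = L2_class \<mu> (\<lambda>x. exp (2 * of_real pi * \<i> * of_real t * of_real x))"

definition canonical_index_set :: "nat \<Rightarrow> real set" where
  "canonical_index_set n =
     {(\<Sum>i\<le>m. a i * (2 * real n) ^ i) | (m :: nat) (a :: nat \<Rightarrow> real).
        \<forall>i\<le>m. a i \<in> {0, real n / 2}}"

lemma L2_rep_class:
  assumes "f \<in> L2_funs M"
  shows "L2_rep (L2_class M f) \<in> L2_funs M" "AE x in M. L2_rep (L2_class M f) x = f x"
proof -
  have "f \<in> L2_class M f" using assms by (simp add: L2_class_def)
  then have "L2_rep (L2_class M f) \<in> L2_class M f" unfolding L2_rep_def
    by (rule someI[of "\<lambda>g. g \<in> L2_class M f"])
  then show "L2_rep (L2_class M f) \<in> L2_funs M" "AE x in M. L2_rep (L2_class M f) x = f x"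
    by (auto simp: L2_class_def)
qed

lemma L2_class_cong:
  assumes "AE x in M. f x = g x"
  shows "L2_class M f = L2_class M g"
proof -
  have "(AE x in M. h x = f x) \<longleftrightarrow> (AE x in M. h x = g x)" for h
  proof
    assume "AE x in M. h x = f x"
    then show "AE x in M. h x = g x" using assms by eventually_elim simp
  next
    assume "AE x in M. h x = g x"
    then show "AE x in M. h x = f x" using assms by eventually_elim simp
  qed
  then show ?thesis by (simp add: L2_class_def)
qed

lemma L2_add_class:
  assumes "f \<in> L2_funs M" "g \<in> L2_funs M"
  shows "L2_add M (L2_class M f) (L2_class M g) = L2_class M (\<lambda>x. f x + g x)"
  unfolding L2_add_def
proof (rule L2_class_cong)
  show "AE x in M. L2_rep (L2_class M f) x + L2_rep (L2_class M g) x = f x + g x"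
    using L2_rep_class(2)[OF assms(1)] L2_rep_class(2)[OF assms(2)] by eventually_elim simp
qed

lemma L2_scale_class:
  assumes "f \<in> L2_funs M"
  shows "L2_scale M c (L2_class M f) = L2_class M (\<lambda>x. c * f x)"
  unfolding L2_scale_def
proof (rule L2_class_cong)
  show "AE x in M. c * L2_rep (L2_class M f) x = c * f x"
    using L2_rep_class(2)[OF assms] by eventually_elim simp
qed

lemma L2_inner_class:
  assumes f: "f \<in> L2_funs M" and g: "g \<in> L2_funs M"
  shows "L2_inner M (L2_class M f) (L2_class M g) = (LINT x|M. f x * cnj (g x))"
proof -
  have meas: "h \<in> borel_measurable M" if "h \<in> L2_funs M" for h
    using that by (simp add: L2_funs_def)
  have cnj_meas: "(\<lambda>x. cnj (h x)) \<in> borel_measurable M" if "h \<in> L2_funs M" for h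
    by (rule measurable_compose[OF meas[OF that] borel_measurable_continuous_onI])
      (rule continuous_on_cnj[OF continuous_on_id])
  show ?thesis
    unfolding L2_inner_def
  proof (rule integral_cong_AE)
    show "AE x in M. L2_rep (L2_class M f) x * cnj (L2_rep (L2_class M g) x) = f x * cnj (g x)"
      using L2_rep_class(2)[OF f] L2_rep_class(2)[OF g] by eventually_elim simp
  qed (intro borel_measurable_times meas cnj_meas L2_rep_class(1) f g)+
qed

end

theory Submission
  imports Defs
begin

text \<open>
  Since \<open>\<Gamma> = 2n\<Gamma> \<squnion> (n/2 + 2n\<Gamma>)\<close>, the operators \<open>S\<^sub>0\<close> and \<open>S\<^sub>1\<close> map the basis injectively onto two
  complementary parts of itself, so they are isometries with orthogonal ranges. The isometry
  \<open>(A, B) \<mapsto> S\<^sub>0 A + S\<^sub>1 B\<close> has closed range by completeness of \<open>L\<^sup>2\<close>, and the range contains the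
  basis; hence every vector has the form \<open>S\<^sub>0 A + S\<^sub>1 B\<close>. On this form the adjoints are
  \<open>S\<^sub>0\<^sup>* (S\<^sub>0 A + S\<^sub>1 B) = A\<close> and \<open>S\<^sub>1\<^sup>* (S\<^sub>0 A + S\<^sub>1 B) = B\<close>, which gives both relations and, without an
  appeal to the Riesz representation theorem, the existence of the adjoints.
\<close>

subsection \<open>Square-integrable functions\<close>

lemma borel_measurable_cnj [measurable]:
  "f \<in> borel_measurable M \<Longrightarrow> (\<lambda>x. cnj (f x)) \<in> borel_measurable M"
  by (rule borel_measurable_continuous_onI[THEN measurable_compose[rotated]])
     (rule continuous_on_cnj[OF continuous_on_id])

lemma L2_funsD:
  assumes "f \<in> L2_funs M"
  shows "f \<in> borel_measurable M" "integrable M (\<lambda>x. (cmod (f x))\<^sup>2)"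
  using assms by (auto simp: L2_funs_def)

lemma L2_funs_scale: "f \<in> L2_funs M \<Longrightarrow> (\<lambda>x. c * f x) \<in> L2_funs M"
  by (auto simp: L2_funs_def norm_mult power_mult_distrib)

lemma L2_funs_zero: "(\<lambda>x. 0) \<in> L2_funs M"
  by (auto simp: L2_funs_def)

lemma norm_add_square_le:
  fixes a b :: "'a::real_normed_vector"
  shows "(norm (a + b))\<^sup>2 \<le> 2 * (norm a)\<^sup>2 + 2 * (norm b)\<^sup>2"
proof -
  have "(norm (a + b))\<^sup>2 \<le> (norm a + norm b)\<^sup>2"
    by (intro power_mono norm_triangle_ineq) auto
  also have "\<dots> \<le> 2 * (norm a)\<^sup>2 + 2 * (norm b)\<^sup>2"
    using sum_squares_bound[of "norm a" "norm b"] by (simp add: power2_sum)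
  finally show ?thesis .
qed

lemma L2_funs_add:
  assumes "f \<in> L2_funs M" "g \<in> L2_funs M"
  shows "(\<lambda>x. f x + g x) \<in> L2_funs M"
proof -
  note [measurable] = L2_funsD(1)[OF assms(1)] L2_funsD(1)[OF assms(2)]
  have "integrable M (\<lambda>x. 2 * (cmod (f x))\<^sup>2 + 2 * (cmod (g x))\<^sup>2)"
    using assms[THEN L2_funsD(2)] by auto
  then have "integrable M (\<lambda>x. (cmod (f x + g x))\<^sup>2)"
    by (rule Bochner_Integration.integrable_bound) (auto simp: norm_add_square_le)
  then show ?thesis by (simp add: L2_funs_def)
qed

lemma integrable_L2_funs_mult_cnj:
  assumes "f \<in> L2_funs M" "g \<in> L2_funs M"
  shows "integrable M (\<lambda>x. f x * cnj (g x))"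
proof -
  note [measurable] = L2_funsD(1)[OF assms(1)] L2_funsD(1)[OF assms(2)]
  have "norm (f x * cnj (g x)) \<le> norm ((cmod (f x))\<^sup>2 + (cmod (g x))\<^sup>2)" for x
  proof -
    have "2 * cmod (f x) * cmod (g x) \<le> (cmod (f x))\<^sup>2 + (cmod (g x))\<^sup>2"
      by (rule sum_squares_bound)
    moreover have "0 \<le> cmod (f x) * cmod (g x)" by simp
    ultimately have "cmod (f x) * cmod (g x) \<le> (cmod (f x))\<^sup>2 + (cmod (g x))\<^sup>2" by linarith
    then show ?thesis by (simp add: norm_mult)
  qed
  moreover have "integrable M (\<lambda>x. (cmod (f x))\<^sup>2 + (cmod (g x))\<^sup>2)"
    using assms[THEN L2_funsD(2)] by auto
  ultimately show ?thesis
    by (intro Bochner_Integration.integrable_bound[where g = "\<lambda>x. f x * cnj (g x)"]) auto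
qed

subsection \<open>Inner product, norm and distance\<close>

lemma L2_E:
  assumes "F \<in> L2 M"
  obtains f where "f \<in> L2_funs M" "F = L2_class M f"
  using assms by (auto simp: L2_def)

lemma L2_zero_closed [simp]: "L2_zero M \<in> L2 M"
  by (simp add: L2_zero_def L2_def L2_funs_zero)

lemma L2_add_closed [simp]: "F \<in> L2 M \<Longrightarrow> G \<in> L2 M \<Longrightarrow> L2_add M F G \<in> L2 M"
  by (auto elim!: L2_E simp: L2_add_class L2_def L2_funs_add)

lemma L2_scale_closed [simp]: "F \<in> L2 M \<Longrightarrow> L2_scale M c F \<in> L2 M"
  by (auto elim!: L2_E simp: L2_scale_class L2_def L2_funs_scale)

lemma L2_inner_add_left:
  "F \<in> L2 M \<Longrightarrow> G \<in> L2 M \<Longrightarrow> H \<in> L2 M \<Longrightarrow>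
    L2_inner M (L2_add M F G) H = L2_inner M F H + L2_inner M G H"
  by (auto elim!: L2_E
      simp: L2_add_class L2_inner_class L2_funs_add integrable_L2_funs_mult_cnj ring_distribs)

lemma L2_inner_scale_left:
  "F \<in> L2 M \<Longrightarrow> H \<in> L2 M \<Longrightarrow> L2_inner M (L2_scale M c F) H = c * L2_inner M F H"
  by (auto elim!: L2_E simp: L2_scale_class L2_inner_class L2_funs_scale mult.assoc)

lemma L2_inner_cnj: "cnj (L2_inner M F G) = L2_inner M G F"
  by (simp add: L2_inner_def mult.commute del: Bochner_Integration.integral_cnj
      flip: Bochner_Integration.integral_cnj)

lemma L2_inner_add_right:
  "F \<in> L2 M \<Longrightarrow> G \<in> L2 M \<Longrightarrow> H \<in> L2 M \<Longrightarrow>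
    L2_inner M H (L2_add M F G) = L2_inner M H F + L2_inner M H G"
  by (metis L2_inner_add_left L2_inner_cnj complex_cnj_add)

lemma L2_inner_scale_right:
  "F \<in> L2 M \<Longrightarrow> H \<in> L2 M \<Longrightarrow> L2_inner M H (L2_scale M c F) = cnj c * L2_inner M H F"
  by (metis L2_inner_scale_left L2_inner_cnj complex_cnj_mult)

text \<open>Lets homogeneity handle the zero vector: the inner-product and operator rules for
  \<open>L2_zero\<close> both come from scaling by 0.\<close>

lemma L2_zero_eq_scale: "F \<in> L2 M \<Longrightarrow> L2_zero M = L2_scale M 0 F"
  by (auto elim!: L2_E simp: L2_scale_class L2_zero_def)

lemma L2_inner_zero:
  assumes "F \<in> L2 M"
  shows "L2_inner M (L2_zero M) F = 0" "L2_inner M F (L2_zero M) = 0"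
  using assms by (simp_all add: L2_zero_eq_scale[OF assms] L2_inner_scale_left L2_inner_scale_right)

lemmas L2_inner_simps =
  L2_inner_add_left L2_inner_add_right L2_inner_scale_left L2_inner_scale_right L2_inner_zero

text \<open>The squared norm stays inside \<open>of_real\<close>, since the inner product is
  complex; norm identities below are proved in the complex numbers and then pulled back.\<close>

lemma L2_inner_self: "L2_inner M F F = of_real ((L2_norm M F)\<^sup>2)"
  by (simp add: L2_inner_def L2_norm_def flip: complex_norm_square of_real_power)

lemma L2_norm_nonneg [simp]: "0 \<le> L2_norm M F"
  by (simp add: L2_norm_def)

lemma L2_norm_class:
  assumes "f \<in> L2_funs M"
  shows "L2_norm M (L2_class M f) = sqrt (LINT x|M. (cmod (f x))\<^sup>2)"
proof -
  note [measurable] = L2_funsD(1)[OF assms] L2_funsD(1)[OF L2_rep_class(1)[OF assms]]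
  have "AE x in M. (cmod (L2_rep (L2_class M f) x))\<^sup>2 = (cmod (f x))\<^sup>2"
    using L2_rep_class(2)[OF assms] by eventually_elim simp
  then have "(LINT x|M. (cmod (L2_rep (L2_class M f) x))\<^sup>2) = (LINT x|M. (cmod (f x))\<^sup>2)"
    by (intro integral_cong_AE) auto
  then show ?thesis by (simp add: L2_norm_def)
qed

text \<open>Testing against F - G makes its norm vanish, so representatives agree almost everywhere.
  This is the extensionality principle used from here on: vector identities become arithmetic with
  \<open>L2_inner_simps\<close>, without unfolding classes.\<close>

lemma L2_eqI:
  assumes F: "F \<in> L2 M" and G: "G \<in> L2 M" and eq: "\<And>H. H \<in> L2 M \<Longrightarrow> L2_inner M H F = L2_inner M H G"
  shows "F = G"
proof -
  obtain f where f: "f \<in> L2_funs M" "F = L2_class M f" using F by (rule L2_E)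
  obtain g where g: "g \<in> L2_funs M" "G = L2_class M g" using G by (rule L2_E)
  let ?D = "L2_add M F (L2_scale M (-1) G)"
  let ?d = "\<lambda>x. f x + -1 * g x"
  have d: "?d \<in> L2_funs M" by (intro L2_funs_add L2_funs_scale f g)
  have D: "?D = L2_class M ?d"
    using L2_add_class[OF f(1) L2_funs_scale[OF g(1), of "-1"]] L2_scale_class[OF g(1), of "-1"] f g
    by simp
  have "L2_inner M ?D ?D = 0"
    using eq[of ?D] F G by (simp add: L2_inner_simps)
  then have "(LINT x|M. (cmod (?d x))\<^sup>2) = 0"
    using L2_norm_class[OF d] by (simp add: L2_inner_self D)
  then have "AE x in M. (cmod (?d x))\<^sup>2 = 0"
    using integral_nonneg_eq_0_iff_AE[OF L2_funsD(2)[OF d]] by simp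
  then have "AE x in M. f x = g x" by eventually_elim simp
  then show ?thesis
    unfolding f g by (rule L2_class_cong)
qed

text \<open>Transferred from the inequality for nonnegative integrals, applied to the moduli of two
  representatives.\<close>

lemma L2_Cauchy_Schwarz:
  assumes "F \<in> L2 M" "G \<in> L2 M"
  shows "cmod (L2_inner M F G) \<le> L2_norm M F * L2_norm M G"
proof -
  obtain f where f: "f \<in> L2_funs M" "F = L2_class M f" using assms(1) by (rule L2_E)
  obtain g where g: "g \<in> L2_funs M" "G = L2_class M g" using assms(2) by (rule L2_E)
  note [measurable] = L2_funsD(1)[OF f(1)] L2_funsD(1)[OF g(1)]
  have nn: "(\<integral>\<^sup>+x. (ennreal (cmod (h x)))\<^sup>2 \<partial>M) = ennreal ((L2_norm M (L2_class M h))\<^sup>2)"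
    if "h \<in> L2_funs M" for h
    using nn_integral_eq_integral[OF L2_funsD(2)[OF that]] L2_norm_class[OF that]
    by (simp add: ennreal_power)
  have "ennreal (cmod (L2_inner M F G)) \<le> (\<integral>\<^sup>+x. ennreal (cmod (f x)) * ennreal (cmod (g x)) \<partial>M)"
    using integral_norm_bound_ennreal[OF integrable_L2_funs_mult_cnj[OF f(1) g(1)]]
    by (simp add: f g L2_inner_class norm_mult ennreal_mult)
  then have "(ennreal (cmod (L2_inner M F G)))\<^sup>2 \<le>
      (\<integral>\<^sup>+x. ennreal (cmod (f x)) * ennreal (cmod (g x)) \<partial>M)\<^sup>2"
    by (rule power_mono) simp
  also have "\<dots> \<le> (\<integral>\<^sup>+x. (ennreal (cmod (f x)))\<^sup>2 \<partial>M) * (\<integral>\<^sup>+x. (ennreal (cmod (g x)))\<^sup>2 \<partial>M)"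
    by (rule Cauchy_Schwarz_nn_integral) auto
  also have "\<dots> = ennreal ((L2_norm M F * L2_norm M G)\<^sup>2)"
    using nn[OF f(1)] nn[OF g(1)] by (simp add: f g power_mult_distrib ennreal_mult)
  finally have "(cmod (L2_inner M F G))\<^sup>2 \<le> (L2_norm M F * L2_norm M G)\<^sup>2"
    by (simp add: ennreal_power ennreal_le_iff)
  then show ?thesis by (rule power2_le_imp_le) simp
qed

text \<open>Expanding the squared norm of the sum leaves the cross term 2 Re <F, G>, which
  Cauchy-Schwarz bounds.\<close>

lemma L2_norm_triangle:
  assumes "F \<in> L2 M" "G \<in> L2 M"
  shows "L2_norm M (L2_add M F G) \<le> L2_norm M F + L2_norm M G"
proof (rule power2_le_imp_le)
  have "complex_of_real ((L2_norm M (L2_add M F G))\<^sup>2) =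
      of_real ((L2_norm M F)\<^sup>2 + (L2_norm M G)\<^sup>2) + (L2_inner M F G + cnj (L2_inner M F G))"
    using assms by (simp add: L2_inner_simps L2_inner_cnj del: of_real_power flip: L2_inner_self)
  then have "(L2_norm M (L2_add M F G))\<^sup>2 =
      (L2_norm M F)\<^sup>2 + (L2_norm M G)\<^sup>2 + 2 * Re (L2_inner M F G)"
    unfolding complex_add_cnj of_real_add[symmetric] of_real_eq_iff by simp
  moreover have "Re (L2_inner M F G) \<le> L2_norm M F * L2_norm M G"
    using complex_Re_le_cmod L2_Cauchy_Schwarz[OF assms] by (rule order_trans)
  ultimately show "(L2_norm M (L2_add M F G))\<^sup>2 \<le> (L2_norm M F + L2_norm M G)\<^sup>2"
    by (simp add: power2_sum)
qed simp

lemma L2_dist_nonneg [simp]: "0 \<le> L2_dist M F G"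
  by (simp add: L2_dist_def)

lemma L2_dist_class:
  assumes "f \<in> L2_funs M" "g \<in> L2_funs M"
  shows "L2_dist M (L2_class M f) (L2_class M g) = sqrt (LINT x|M. (cmod (f x - g x))\<^sup>2)"
  unfolding L2_dist_def L2_scale_class[OF assms(2)]
    L2_add_class[OF assms(1) L2_funs_scale[OF assms(2)]]
    L2_norm_class[OF L2_funs_add[OF assms(1) L2_funs_scale[OF assms(2)]]] by simp

lemma L2_dist_commute: "F \<in> L2 M \<Longrightarrow> G \<in> L2 M \<Longrightarrow> L2_dist M F G = L2_dist M G F"
  by (auto elim!: L2_E simp: L2_dist_class norm_minus_commute)

lemma L2_dist_triangle:
  assumes "F \<in> L2 M" "G \<in> L2 M" "H \<in> L2 M"
  shows "L2_dist M F H \<le> L2_dist M F G + L2_dist M G H"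
proof -
  \<comment> \<open>F - H = (F - G) + (G - H), so the norm inequality applies.\<close>
  have "L2_add M F (L2_scale M (-1) H) =
      L2_add M (L2_add M F (L2_scale M (-1) G)) (L2_add M G (L2_scale M (-1) H))"
    using assms by (intro L2_eqI[of _ M]) (auto simp: L2_inner_simps)
  then show ?thesis
    using assms by (simp add: L2_dist_def L2_norm_triangle)
qed

text \<open>Cauchy-Schwarz for F - G and H; it serves as continuity of the inner product in its
  first argument.\<close>

lemma L2_inner_diff_le:
  assumes "F \<in> L2 M" "G \<in> L2 M" "H \<in> L2 M"
  shows "cmod (L2_inner M F H - L2_inner M G H) \<le> L2_dist M F G * L2_norm M H"
  using assms L2_Cauchy_Schwarz[of "L2_add M F (L2_scale M (-1) G)" M H]
  by (simp add: L2_dist_def L2_inner_simps)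

lemma L2_dist_eq_0D:
  assumes "F \<in> L2 M" "G \<in> L2 M" "L2_dist M F G = 0"
  shows "F = G"
proof (rule L2_eqI)
  fix H assume "H \<in> L2 M"
  then have "L2_inner M F H = L2_inner M G H"
    using L2_inner_diff_le[of F M G H] assms by simp
  then show "L2_inner M H F = L2_inner M H G" by (metis L2_inner_cnj)
qed (use assms in auto)

subsection \<open>Completeness\<close>

text \<open>
  Along a subsequence with \<open>\<integral>\<bar>d\<^sub>k\<bar>\<^sup>2 \<le> 8\<^sup>-\<^sup>k\<close> for the increments \<open>d\<^sub>k\<close>, the sum of \<open>2\<^sup>k \<bar>d\<^sub>k\<bar>\<^sup>2\<close> is finite
  almost everywhere, and \<open>\<bar>d\<^sub>k\<bar> \<le> 2\<^sup>-\<^sup>k + 2\<^sup>k \<bar>d\<^sub>k\<bar>\<^sup>2\<close> makes the increments summable.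
\<close>

lemma L2_funs_Cauchy_AE_convergent_subseq:
  fixes f :: "nat \<Rightarrow> 'a \<Rightarrow> complex"
  assumes f: "\<And>k. f k \<in> L2_funs M"
    and Cauchy: "\<And>e. e > 0 \<Longrightarrow> \<exists>N. \<forall>m\<ge>N. \<forall>n\<ge>N. (LINT x|M. (cmod (f m x - f n x))\<^sup>2) \<le> e"
  obtains r where "filterlim r at_top sequentially" "AE x in M. convergent (\<lambda>k. f (r k) x)"
proof -
  note [measurable] = L2_funsD(1)[OF f]
  have diff: "(\<lambda>x. f m x - f n x) \<in> L2_funs M" for m n
    using L2_funs_add[OF f L2_funs_scale[OF f, of "-1"]] by simp
  have "\<forall>k. \<exists>N. \<forall>m\<ge>N. \<forall>n\<ge>N. (LINT x|M. (cmod (f m x - f n x))\<^sup>2) \<le> (1/8) ^ k"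
    using Cauchy by simp
  then obtain N where
    N: "\<And>k m n. m \<ge> N k \<Longrightarrow> n \<ge> N k \<Longrightarrow> (LINT x|M. (cmod (f m x - f n x))\<^sup>2) \<le> (1/8) ^ k"
    by metis
  \<comment> \<open>The partial sum makes \<open>r\<close> monotone and at least \<open>N k\<close>,
    so both indices of an increment are beyond \<open>N k\<close>; the summand \<open>k\<close>
    forces \<open>r\<close> to infinity.\<close>
  define r where "r k = (\<Sum>j\<le>k. N j) + k" for k
  have r: "N k \<le> r k" "r k \<le> r (Suc k)" "k \<le> r k" for k
    using member_le_sum[of k "{..k}" N] by (auto simp: r_def)
  define d where "d k x = f (r (Suc k)) x - f (r k) x" for k x
  have [measurable]: "d k \<in> borel_measurable M" for k
    unfolding d_def by simp
  have "(\<integral>\<^sup>+x. (\<Sum>k. ennreal (2 ^ k * (cmod (d k x))\<^sup>2)) \<partial>M) =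
      (\<Sum>k. \<integral>\<^sup>+x. ennreal (2 ^ k * (cmod (d k x))\<^sup>2) \<partial>M)"
    by (rule nn_integral_suminf) simp
  also have "\<dots> \<le> (\<Sum>k. ennreal ((1/4) ^ k))"
  proof (intro suminf_le allI summableI)
    fix k
    have "(\<integral>\<^sup>+x. ennreal (2 ^ k * (cmod (d k x))\<^sup>2) \<partial>M) = ennreal (LINT x|M. 2 ^ k * (cmod (d k x))\<^sup>2)"
      using L2_funsD(2)[OF diff] unfolding d_def by (intro nn_integral_eq_integral) auto
    also have "(LINT x|M. 2 ^ k * (cmod (d k x))\<^sup>2) \<le> 2 ^ k * (1/8) ^ k"
      using N[of k "r (Suc k)" "r k"] r[of k] by (simp add: d_def)
    also have "(2::real) ^ k * (1/8) ^ k = (1/4) ^ k"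
      by (simp flip: power_mult_distrib)
    finally show "(\<integral>\<^sup>+x. ennreal (2 ^ k * (cmod (d k x))\<^sup>2) \<partial>M) \<le> ennreal ((1/4) ^ k)"
      by (simp add: ennreal_leI)
  qed
  also have "\<dots> < \<infinity>"
  proof -
    have "(\<Sum>k. ennreal ((1/4) ^ k)) \<noteq> top"
      by (rule ennreal_suminf_neq_top[OF summable_geometric]) auto
    then show ?thesis by (simp only: infinity_ennreal_def top.not_eq_extremum)
  qed
  finally have "AE x in M. (\<Sum>k. ennreal (2 ^ k * (cmod (d k x))\<^sup>2)) \<noteq> \<infinity>"
    by (intro nn_integral_PInf_AE) auto
  then have "AE x in M. convergent (\<lambda>k. f (r k) x)"
  proof eventually_elim
    case (elim x)
    then have "summable (\<lambda>k. 2 ^ k * (cmod (d k x))\<^sup>2)"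
      by (intro summable_suminf_not_top) auto
    then have "summable (\<lambda>k. (1/2) ^ k + 2 ^ k * (cmod (d k x))\<^sup>2)"
      by (intro summable_add) (simp_all add: summable_geometric)
    moreover have "norm (d k x) \<le> (1/2) ^ k + 2 ^ k * (cmod (d k x))\<^sup>2" for k
    proof (cases "cmod (d k x) \<le> (1/2) ^ k")
      \<comment> \<open>Here 2^k |d| exceeds 1, so multiplying by |d| lets the quadratic term
        dominate; in the other case the geometric term suffices.\<close>
      case False
      then have "1 * cmod (d k x) \<le> (2 ^ k * cmod (d k x)) * cmod (d k x)"
        by (intro mult_right_mono) (auto simp: field_simps)
      then show ?thesis
        by (simp add: power2_eq_square mult.assoc add_increasing)
    qed (simp add: add_increasing2)
    ultimately have "summable (\<lambda>k. d k x)"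
      by (rule summable_comparison_test'[where N = 0])
    then have "convergent (\<lambda>k. (\<Sum>i<k. d i x) + f (r 0) x)"
      by (intro convergent_add convergent_const) (simp add: summable_iff_convergent)
    moreover have "(\<Sum>i<k. d i x) + f (r 0) x = f (r k) x" for k
      unfolding d_def by (subst sum_lessThan_telescope) simp
    ultimately show ?case by simp
  qed
  moreover have "filterlim r at_top sequentially"
    by (rule filterlim_at_top_mono[OF filterlim_ident]) (simp add: r(3))
  ultimately show thesis using that[of r] by simp
qed

text \<open>Riesz-Fischer: take the pointwise limit g along the subsequence. Fatou's lemma for |f n
  - f (r k)|^2, with n fixed and k tending to infinity, bounds the integral of |f n - g|^2, so the
  whole sequence converges.\<close>

lemma L2_funs_complete:
  fixes f :: "nat \<Rightarrow> 'a \<Rightarrow> complex"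
  assumes f: "\<And>k. f k \<in> L2_funs M"
    and Cauchy: "\<And>e. e > 0 \<Longrightarrow> \<exists>N. \<forall>m\<ge>N. \<forall>n\<ge>N. (LINT x|M. (cmod (f m x - f n x))\<^sup>2) \<le> e"
  obtains g where "g \<in> L2_funs M" "(\<lambda>n. LINT x|M. (cmod (f n x - g x))\<^sup>2) \<longlonglongrightarrow> 0"
proof -
  note [measurable] = L2_funsD(1)[OF f]
  have diff: "(\<lambda>x. f m x - f n x) \<in> L2_funs M" for m n
    using L2_funs_add[OF f L2_funs_scale[OF f, of "-1"]] by simp
  obtain r where r: "filterlim r at_top sequentially" "AE x in M. convergent (\<lambda>k. f (r k) x)"
    by (rule L2_funs_Cauchy_AE_convergent_subseq[of f M, OF f Cauchy])
  \<comment> \<open>\<open>lim\<close> is total, so \<open>g\<close> is measurable everywhere; its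
    unspecified values occur only on the null set without convergence.\<close>
  define g where "g x = lim (\<lambda>k. f (r k) x)" for x
  have [measurable]: "g \<in> borel_measurable M"
    unfolding g_def by measurable
  have bound: "(\<integral>\<^sup>+x. ennreal ((cmod (f n x - g x))\<^sup>2) \<partial>M) \<le> ennreal e"
    if N: "\<forall>m\<ge>N. \<forall>n\<ge>N. (LINT x|M. (cmod (f m x - f n x))\<^sup>2) \<le> e" and "n \<ge> N" for n N e
  proof -
    have "AE x in M. ennreal ((cmod (f n x - g x))\<^sup>2) =
        liminf (\<lambda>k. ennreal ((cmod (f n x - f (r k) x))\<^sup>2))"
      using r(2)
    proof eventually_elim
      case (elim x)
      then have "(\<lambda>k. f (r k) x) \<longlonglongrightarrow> g x"
        by (simp add: convergent_LIMSEQ_iff g_def)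
      then have "(\<lambda>k. ennreal ((cmod (f n x - f (r k) x))\<^sup>2)) \<longlonglongrightarrow> ennreal ((cmod (f n x - g x))\<^sup>2)"
        by (intro tendsto_intros)
      then show ?case by (intro lim_imp_Liminf[symmetric]) auto
    qed
    then have "(\<integral>\<^sup>+x. ennreal ((cmod (f n x - g x))\<^sup>2) \<partial>M) =
        (\<integral>\<^sup>+x. liminf (\<lambda>k. ennreal ((cmod (f n x - f (r k) x))\<^sup>2)) \<partial>M)"
      by (rule nn_integral_cong_AE)
    also have "\<dots> \<le> liminf (\<lambda>k. \<integral>\<^sup>+x. ennreal ((cmod (f n x - f (r k) x))\<^sup>2) \<partial>M)"
      by (rule nn_integral_liminf) simp
    also have "\<dots> \<le> liminf (\<lambda>k. ennreal e)"
    proof (rule Liminf_mono)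
      \<comment> \<open>The Cauchy estimate holds once \<open>r k\<close> has passed
        \<open>N\<close>, which is enough for a bound on the limit inferior.\<close>
      have "eventually (\<lambda>k. r k \<ge> N) sequentially"
        using r(1) by (simp add: filterlim_at_top)
      then show "eventually (\<lambda>k. (\<integral>\<^sup>+x. ennreal ((cmod (f n x - f (r k) x))\<^sup>2) \<partial>M) \<le> ennreal e) sequentially"
      proof eventually_elim
        case (elim k)
        have "(\<integral>\<^sup>+x. ennreal ((cmod (f n x - f (r k) x))\<^sup>2) \<partial>M) =
            ennreal (LINT x|M. (cmod (f n x - f (r k) x))\<^sup>2)"
          using L2_funsD(2)[OF diff] by (intro nn_integral_eq_integral) auto
        then show ?case using N elim \<open>n \<ge> N\<close> by (simp add: ennreal_leI)
      qed
    qed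
    also have "\<dots> = ennreal e" by (simp add: Liminf_const)
    finally show ?thesis .
  qed
  have fg: "(\<lambda>x. f n x - g x) \<in> L2_funs M \<and> (LINT x|M. (cmod (f n x - g x))\<^sup>2) \<le> e"
    if N: "\<forall>m\<ge>N. \<forall>n\<ge>N. (LINT x|M. (cmod (f m x - f n x))\<^sup>2) \<le> e" and "n \<ge> N" "e > 0" for n N e
  proof -
    have le: "(\<integral>\<^sup>+x. ennreal ((cmod (f n x - g x))\<^sup>2) \<partial>M) \<le> ennreal e"
      using bound[OF that(1,2)] .
    then have int: "integrable M (\<lambda>x. (cmod (f n x - g x))\<^sup>2)"
      by (intro integrableI_bounded) (auto simp: le_less_trans[OF _ ennreal_less_top])
    then have "ennreal (LINT x|M. (cmod (f n x - g x))\<^sup>2) \<le> ennreal e"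
      using le by (subst (asm) nn_integral_eq_integral) auto
    then show ?thesis using int \<open>e > 0\<close> by (simp add: L2_funs_def ennreal_le_iff)
  qed
  show thesis
  proof
    obtain N where "\<forall>m\<ge>N. \<forall>n\<ge>N. (LINT x|M. (cmod (f m x - f n x))\<^sup>2) \<le> 1"
      using Cauchy[of 1] by auto
    \<comment> \<open>\<open>g\<close> inherits square integrability from f N - (f N - g).\<close>
    then have "(\<lambda>x. f N x - g x) \<in> L2_funs M" using fg[of N 1 N] by auto
    then show "g \<in> L2_funs M"
      using L2_funs_add[OF f[of N] L2_funs_scale[of "\<lambda>x. f N x - g x" M "-1"]] by simp
    show "(\<lambda>n. LINT x|M. (cmod (f n x - g x))\<^sup>2) \<longlonglongrightarrow> 0"
    proof (rule LIMSEQ_I)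
      fix e :: real assume "e > 0"
      then obtain N where "\<forall>m\<ge>N. \<forall>n\<ge>N. (LINT x|M. (cmod (f m x - f n x))\<^sup>2) \<le> e / 2"
        using Cauchy[of "e / 2"] by auto
      then have "\<forall>n\<ge>N. (LINT x|M. (cmod (f n x - g x))\<^sup>2) \<le> e / 2"
        using fg[of N "e / 2"] \<open>e > 0\<close> by auto
      then show "\<exists>N. \<forall>n\<ge>N. norm ((LINT x|M. (cmod (f n x - g x))\<^sup>2) - 0) < e"
        using \<open>e > 0\<close> by (intro exI[of _ N]) (auto intro: le_less_trans[of _ "e / 2"])
    qed
  qed
qed

lemma L2_complete:
  assumes F: "\<And>k. F k \<in> L2 M"
    and Cauchy: "\<And>e. e > 0 \<Longrightarrow> \<exists>N. \<forall>m\<ge>N. \<forall>n\<ge>N. L2_dist M (F m) (F n) < e"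
  obtains G where "G \<in> L2 M" "(\<lambda>k. L2_dist M (F k) G) \<longlonglongrightarrow> 0"
proof -
  have "\<forall>k. \<exists>f. f \<in> L2_funs M \<and> F k = L2_class M f"
    using F by (metis L2_E)
  then obtain f where f: "\<And>k. f k \<in> L2_funs M" "\<And>k. F k = L2_class M (f k)"
    by metis
  have C: "\<exists>N. \<forall>m\<ge>N. \<forall>n\<ge>N. (LINT x|M. (cmod (f m x - f n x))\<^sup>2) \<le> e" if "e > 0" for e
  proof -
    have "L2_dist M (F m) (F n) < sqrt e \<Longrightarrow> (LINT x|M. (cmod (f m x - f n x))\<^sup>2) \<le> e" for m n
      by (simp add: f L2_dist_class)
    then show ?thesis using Cauchy[of "sqrt e"] that by (meson real_sqrt_gt_zero)
  qed
  obtain g where g: "g \<in> L2_funs M" "(\<lambda>n. LINT x|M. (cmod (f n x - g x))\<^sup>2) \<longlonglongrightarrow> 0"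
    by (rule L2_funs_complete[of f M, OF f(1) C])
  have "(\<lambda>k. L2_dist M (F k) (L2_class M g)) \<longlonglongrightarrow> 0"
    using tendsto_real_sqrt[OF g(2)] by (simp add: f g L2_dist_class)
  moreover have "L2_class M g \<in> L2 M" using g by (simp add: L2_def)
  ultimately show thesis using that by blast
qed

subsection \<open>Bounded operators and orthonormal bases\<close>

lemma L2_add_zero:
  assumes "F \<in> L2 M"
  shows "L2_add M F (L2_zero M) = F" "L2_add M (L2_zero M) F = F"
  using assms by - (rule L2_eqI[of _ M]; simp add: L2_inner_simps)+

text \<open>The span of the basis is contained in V and dense, and V is closed. Closedness is the
  premise \<open>closed\<close>, stated through approximation by \<open>L2_dist\<close> because
  \<open>L2 M\<close> is a carrier set and not a topological type.\<close>

lemma L2_basis_subspace_eq: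
  assumes "L2_orthonormal_basis M I E" "L2_subspace M V" "E ` I \<subseteq> V"
    and closed: "\<And>F. F \<in> L2 M \<Longrightarrow> (\<And>\<epsilon>. \<epsilon> > 0 \<Longrightarrow> \<exists>G\<in>V. L2_dist M F G < \<epsilon>) \<Longrightarrow> F \<in> V"
  shows "V = L2 M"
proof
  show "V \<subseteq> L2 M" using assms(2) by (simp add: L2_subspace_def)
  have "L2_subspace M hull (E ` I) \<subseteq> V" using assms(2,3) by (intro hull_minimal)
  then show "L2 M \<subseteq> V"
    using assms(1) closed unfolding L2_orthonormal_basis_def by (meson subsetD subsetI)
qed

lemma L2_bounded_linearD:
  assumes "L2_bounded_linear M T" "F \<in> L2 M"
  shows "T F \<in> L2 M" "T (L2_scale M c F) = L2_scale M c (T F)"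
    "G \<in> L2 M \<Longrightarrow> T (L2_add M F G) = L2_add M (T F) (T G)"
  using assms by (simp_all add: L2_bounded_linear_def)

lemma L2_bounded_linear_zero:
  assumes "L2_bounded_linear M T"
  shows "T (L2_zero M) = L2_zero M"
  using L2_bounded_linearD(1)[OF assms L2_zero_closed]
    L2_bounded_linearD(2)[OF assms L2_zero_closed, of 0]
  by (metis L2_zero_closed L2_zero_eq_scale)

lemma L2_bounded_linear_dist_le:
  assumes "L2_bounded_linear M T"
  obtains K where "K \<ge> 0"
    "\<And>F G. F \<in> L2 M \<Longrightarrow> G \<in> L2 M \<Longrightarrow> L2_dist M (T F) (T G) \<le> K * L2_dist M F G"
proof -
  obtain K where K: "\<And>F. F \<in> L2 M \<Longrightarrow> L2_norm M (T F) \<le> K * L2_norm M F"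
    using assms unfolding L2_bounded_linear_def by blast
  show thesis
  proof
    \<comment> \<open>The bound in \<open>L2_bounded_linear\<close> carries no sign; the absolute
      value supplies a nonnegative Lipschitz constant.\<close>
    show "\<bar>K\<bar> \<ge> 0" by simp
    fix F G assume FG: "F \<in> L2 M" "G \<in> L2 M"
    have "L2_dist M (T F) (T G) = L2_norm M (T (L2_add M F (L2_scale M (-1) G)))"
      using FG by (simp add: L2_dist_def L2_bounded_linearD[OF assms])
    also have "\<dots> \<le> K * L2_dist M F G"
      unfolding L2_dist_def using FG by (intro K) simp
    also have "\<dots> \<le> \<bar>K\<bar> * L2_dist M F G" by (intro mult_right_mono) auto
    finally show "L2_dist M (T F) (T G) \<le> \<bar>K\<bar> * L2_dist M F G" .
  qed
qed

text \<open>Both sides are continuous and linear in F, so the set where they agree is a closed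
  subspace. This reduces adjoint identities to basis vectors.\<close>

lemma L2_inner_eq_on_basis:
  assumes E: "L2_orthonormal_basis M I E" and T: "L2_bounded_linear M T"
    and G: "G \<in> L2 M" and H: "H \<in> L2 M"
    and eq: "\<And>i. i \<in> I \<Longrightarrow> L2_inner M (T (E i)) G = L2_inner M (E i) H"
    and F: "F \<in> L2 M"
  shows "L2_inner M (T F) G = L2_inner M F H"
proof -
  note T_simps = L2_bounded_linearD[OF T] L2_bounded_linear_zero[OF T]
  define V where "V = {F \<in> L2 M. L2_inner M (T F) G = L2_inner M F H}"
  obtain K where K: "K \<ge> 0"
    "\<And>F F'. F \<in> L2 M \<Longrightarrow> F' \<in> L2 M \<Longrightarrow> L2_dist M (T F) (T F') \<le> K * L2_dist M F F'"
    using L2_bounded_linear_dist_le[OF T] by blast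
  have "V = L2 M"
  proof (rule L2_basis_subspace_eq[OF E])
    show "L2_subspace M V"
      using G H unfolding L2_subspace_def V_def by (auto simp: T_simps L2_inner_simps)
    show "E ` I \<subseteq> V"
      using E eq by (auto simp: V_def L2_orthonormal_basis_def)
    fix F assume F: "F \<in> L2 M" and approx: "\<And>\<epsilon>. \<epsilon> > 0 \<Longrightarrow> \<exists>F'\<in>V. L2_dist M F F' < \<epsilon>"
    let ?d = "cmod (L2_inner M (T F) G - L2_inner M F H)" and ?C = "K * L2_norm M G + L2_norm M H"
    have C: "?C \<ge> 0" using K by simp
    have "?d \<le> \<epsilon>" if "\<epsilon> > 0" for \<epsilon>
    proof -
      \<comment> \<open>\<open>?C\<close> is a Lipschitz constant for F \<mapsto> <T F, G> - <F, H>;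
        adding 1 keeps the divisor positive.\<close>
      have "\<epsilon> / (?C + 1) > 0" using that C by (intro divide_pos_pos) auto
      then obtain F' where F': "F' \<in> L2 M" "L2_inner M (T F') G = L2_inner M F' H"
        "L2_dist M F F' < \<epsilon> / (?C + 1)"
        using approx[of "\<epsilon> / (?C + 1)"] unfolding V_def by blast
      have "?d = cmod ((L2_inner M (T F) G - L2_inner M (T F') G) -
          (L2_inner M F H - L2_inner M F' H))"
        by (simp add: F'(2))
      also have "\<dots> \<le> L2_dist M (T F) (T F') * L2_norm M G + L2_dist M F F' * L2_norm M H"
        using F F' G H by (intro order_trans[OF norm_triangle_ineq4] add_mono L2_inner_diff_le T_simps)
      also have "\<dots> \<le> (K * L2_dist M F F') * L2_norm M G + L2_dist M F F' * L2_norm M H"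
        using K(2)[OF F F'(1)] by (intro add_mono mult_right_mono) auto
      also have "\<dots> = L2_dist M F F' * ?C" by (simp add: algebra_simps)
      also have "\<dots> \<le> L2_dist M F F' * (?C + 1)" by (intro mult_left_mono) auto
      also have "\<dots> \<le> \<epsilon>" using F'(3) C by (simp add: pos_less_divide_eq)
      finally show ?thesis .
    qed
    then have "?d \<le> 0" by (intro field_le_epsilon[of ?d 0]) (simp only: add_0)
    then show "F \<in> V" using F by (simp add: V_def)
  qed
  then show ?thesis using F by (auto simp: V_def)
qed

text \<open>\<open>L2_eqI\<close> makes the vector in the definite description unique, so exhibiting
  one candidate determines the adjoint.\<close>

lemma L2_adjoint_eqI:
  assumes "H \<in> L2 M" "\<And>F. F \<in> L2 M \<Longrightarrow> L2_inner M (T F) G = L2_inner M F H"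
  shows "L2_adjoint M T G = H"
  unfolding L2_adjoint_def
proof (rule the_equality)
  fix H' assume H': "H' \<in> L2 M \<and> (\<forall>F\<in>L2 M. L2_inner M (T F) G = L2_inner M F H')"
  show "H' = H" using H' assms by (intro L2_eqI) auto
qed (use assms in auto)

subsection \<open>Isometries that split an orthonormal basis\<close>

text \<open>\<open>s i\<close> is the action of \<open>S i\<close> on basis indices.
  \<open>s_eq_iff\<close> encodes at once that both maps are injective and that their images are
  disjoint; \<open>index_split\<close> says that the images exhaust the index set.\<close>

locale L2_basis_splitting =
  fixes M :: "'a measure" and I :: "'i set" and E :: "'i \<Rightarrow> ('a \<Rightarrow> complex) set"
    and S :: "nat \<Rightarrow> ('a \<Rightarrow> complex) set \<Rightarrow> ('a \<Rightarrow> complex) set" and s :: "nat \<Rightarrow> 'i \<Rightarrow> 'i"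
  assumes basis: "L2_orthonormal_basis M I E"
    and bounded_linear: "i < 2 \<Longrightarrow> L2_bounded_linear M (S i)"
    and S_basis: "i < 2 \<Longrightarrow> k \<in> I \<Longrightarrow> S i (E k) = E (s i k)"
    and s_eq_iff: "i < 2 \<Longrightarrow> j < 2 \<Longrightarrow> k \<in> I \<Longrightarrow> l \<in> I \<Longrightarrow> s i k = s j l \<longleftrightarrow> i = j \<and> k = l"
    and index_split: "I = s 0 ` I \<union> s 1 ` I"
begin

lemma s_closed: "i < 2 \<Longrightarrow> k \<in> I \<Longrightarrow> s i k \<in> I"
  using index_split by (auto simp: less_2_cases_iff)

lemma E_closed [simp]: "k \<in> I \<Longrightarrow> E k \<in> L2 M"
  using basis by (simp add: L2_orthonormal_basis_def)

lemma E_inner: "k \<in> I \<Longrightarrow> l \<in> I \<Longrightarrow> L2_inner M (E k) (E l) = (if k = l then 1 else 0)"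
  using basis by (simp add: L2_orthonormal_basis_def)

lemma S_closed [simp]: "i < 2 \<Longrightarrow> F \<in> L2 M \<Longrightarrow> S i F \<in> L2 M"
  by (rule L2_bounded_linearD(1)[OF bounded_linear])

lemmas S_scale = L2_bounded_linearD(2)[OF bounded_linear]
  and S_add = L2_bounded_linearD(3)[OF bounded_linear]
  and S_zero = L2_bounded_linear_zero[OF bounded_linear]

text \<open>On basis vectors this is orthonormality combined with \<open>s_eq_iff\<close>. The
  extension by \<open>L2_inner_eq_on_basis\<close> works in the first slot only, so it is applied
  twice, with a conjugation swapping the slots in between.\<close>

lemma S_inner:
  assumes i: "i < 2" and j: "j < 2" and F: "F \<in> L2 M" and G: "G \<in> L2 M"
  shows "L2_inner M (S i F) (S j G) = (if i = j then L2_inner M F G else 0)"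
proof -
  let ?c = "if i = j then 1 else 0 :: complex"
  have "L2_inner M (S j G) (S i F) = L2_inner M G (L2_scale M ?c F)"
  proof (rule L2_inner_eq_on_basis[OF basis bounded_linear[OF j] _ _ _ G])
    fix l assume l: "l \<in> I"
    have "L2_inner M (S i F) (E (s j l)) = L2_inner M F (L2_scale M ?c (E l))"
    proof (rule L2_inner_eq_on_basis[OF basis bounded_linear[OF i] _ _ _ F])
      fix k assume k: "k \<in> I"
      show "L2_inner M (S i (E k)) (E (s j l)) = L2_inner M (E k) (L2_scale M ?c (E l))"
        using i j k l by (simp add: S_basis E_inner s_closed s_eq_iff L2_inner_simps)
    qed (use j l in \<open>simp_all add: s_closed\<close>)
    then have "cnj (L2_inner M (S i F) (E (s j l))) = cnj (L2_inner M F (L2_scale M ?c (E l)))"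
      by (rule arg_cong)
    then show "L2_inner M (S j (E l)) (S i F) = L2_inner M (E l) (L2_scale M ?c F)"
      using j l F by (simp add: L2_inner_cnj S_basis L2_inner_simps split: if_splits)
  qed (use i F in simp_all)
  then have "cnj (L2_inner M (S j G) (S i F)) = cnj (L2_inner M G (L2_scale M ?c F))"
    by (rule arg_cong)
  then show ?thesis using F G by (simp add: L2_inner_cnj L2_inner_simps split: if_splits)
qed

section \<open>The isometry (A, B) \<mapsto> S 0 A + S 1 B and its range\<close>

abbreviation combine :: "('a \<Rightarrow> complex) set \<Rightarrow> ('a \<Rightarrow> complex) set \<Rightarrow> ('a \<Rightarrow> complex) set" where
  "combine A B \<equiv> L2_add M (S 0 A) (S 1 B)"

lemma combine_add:
  assumes "A \<in> L2 M" "B \<in> L2 M" "A' \<in> L2 M" "B' \<in> L2 M"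
  shows "L2_add M (combine A B) (combine A' B') = combine (L2_add M A A') (L2_add M B B')"
  using assms by (intro L2_eqI[of _ M]) (auto simp: S_add L2_inner_simps)

lemma combine_scale:
  assumes "A \<in> L2 M" "B \<in> L2 M"
  shows "L2_scale M c (combine A B) = combine (L2_scale M c A) (L2_scale M c B)"
  using assms by (intro L2_eqI[of _ M]) (auto simp: S_scale L2_inner_simps ring_distribs)

text \<open>Pythagoras: by \<open>S_inner\<close> the cross terms vanish and each operator preserves
  norms.\<close>

lemma combine_norm:
  assumes "A \<in> L2 M" "B \<in> L2 M"
  shows "(L2_norm M (combine A B))\<^sup>2 = (L2_norm M A)\<^sup>2 + (L2_norm M B)\<^sup>2"
proof -
  have "complex_of_real ((L2_norm M (combine A B))\<^sup>2) = of_real ((L2_norm M A)\<^sup>2 + (L2_norm M B)\<^sup>2)"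
    using assms by (simp add: L2_inner_simps S_inner del: of_real_power flip: L2_inner_self)
  then show ?thesis by (simp only: of_real_eq_iff)
qed

lemma combine_dist:
  assumes "A \<in> L2 M" "B \<in> L2 M" "A' \<in> L2 M" "B' \<in> L2 M"
  shows "(L2_dist M (combine A B) (combine A' B'))\<^sup>2 = (L2_dist M A A')\<^sup>2 + (L2_dist M B B')\<^sup>2"
  using assms by (simp add: L2_dist_def combine_scale combine_add combine_norm del: One_nat_def)

text \<open>The range is a subspace containing the basis, so only closedness remains. If images
  converge, their preimages are Cauchy by \<open>combine_dist\<close>, and the limits of the
  components yield a preimage of the limit.\<close>

lemma combine_surj:
  assumes "F \<in> L2 M"
  obtains A B where "A \<in> L2 M" "B \<in> L2 M" "F = combine A B"
proof -
  define V where "V = {combine A B | A B. A \<in> L2 M \<and> B \<in> L2 M}"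
  have VI: "combine A B \<in> V" if "A \<in> L2 M" "B \<in> L2 M" for A B
    using that by (auto simp: V_def)
  have "V = L2 M"
  proof (rule L2_basis_subspace_eq[OF basis])
    have "combine (L2_zero M) (L2_zero M) = L2_zero M"
      by (simp add: S_zero L2_add_zero)
    then have "L2_zero M \<in> V"
      using VI[OF L2_zero_closed L2_zero_closed] by simp
    then show "L2_subspace M V"
      unfolding L2_subspace_def by (auto simp: V_def combine_add combine_scale simp del: One_nat_def)
        (blast intro: L2_add_closed L2_scale_closed)+
    \<comment> \<open>By \<open>index_split\<close> every basis vector has one of these two
      forms.\<close>
    have "E (s 0 k) = combine (E k) (L2_zero M)" "E (s 1 k) = combine (L2_zero M) (E k)"
      if "k \<in> I" for k
      using that by (simp_all add: S_basis S_zero s_closed L2_add_zero del: One_nat_def)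
    then show "E ` I \<subseteq> V"
      using index_split VI E_closed L2_zero_closed by (metis (no_types, lifting) Un_iff image_iff image_subsetI)
  next
    fix F assume F: "F \<in> L2 M" and approx: "\<And>\<epsilon>. \<epsilon> > 0 \<Longrightarrow> \<exists>G\<in>V. L2_dist M F G < \<epsilon>"
    have "\<forall>k. \<exists>A B. A \<in> L2 M \<and> B \<in> L2 M \<and> L2_dist M F (combine A B) < inverse (Suc k)"
    proof
      fix k
      have "inverse (real (Suc k)) > 0" by simp
      from approx[OF this]
      show "\<exists>A B. A \<in> L2 M \<and> B \<in> L2 M \<and> L2_dist M F (combine A B) < inverse (Suc k)"
        unfolding V_def by blast
    qed
    then obtain A B where A: "\<And>k. A k \<in> L2 M" and B: "\<And>k. B k \<in> L2 M"
      and lim: "\<And>k. L2_dist M F (combine (A k) (B k)) < inverse (Suc k)"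
      by metis
    let ?G = "\<lambda>k. combine (A k) (B k)"
    have G: "?G k \<in> L2 M" for k using A B by simp
    have G_lim: "(\<lambda>k. L2_dist M F (?G k)) \<longlonglongrightarrow> 0"
      by (rule tendsto_sandwich[OF _ _ tendsto_const LIMSEQ_inverse_real_of_nat])
        (simp_all add: less_imp_le[OF lim] del: of_nat_Suc One_nat_def)
    have G_Cauchy: "\<exists>N. \<forall>m\<ge>N. \<forall>n\<ge>N. L2_dist M (?G m) (?G n) < e" if "e > 0" for e
    proof -
      obtain N where N: "\<And>n. n \<ge> N \<Longrightarrow> L2_dist M F (?G n) < e / 2"
        using order_tendstoD(2)[OF G_lim, of "e / 2"] \<open>e > 0\<close> by (auto simp: eventually_sequentially)
      have "L2_dist M (?G m) (?G n) < e" if "m \<ge> N" "n \<ge> N" for m n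
        using L2_dist_triangle[OF G F G, of m n] L2_dist_commute[OF G F, of m] N[OF that(1)] N[OF that(2)]
        by linarith
      then show ?thesis by blast
    qed
    \<comment> \<open>Each component distance is one leg of the Pythagorean identity
      \<open>combine_dist\<close>.\<close>
    have dist_le: "L2_dist M (A m) (A n) \<le> L2_dist M (?G m) (?G n)"
      "L2_dist M (B m) (B n) \<le> L2_dist M (?G m) (?G n)" for m n
      by (rule power2_le_imp_le; simp add: combine_dist A B del: One_nat_def)+
    obtain A' where A': "A' \<in> L2 M" "(\<lambda>k. L2_dist M (A k) A') \<longlonglongrightarrow> 0"
    proof (rule L2_complete[of A, OF A])
      show "\<exists>N. \<forall>m\<ge>N. \<forall>n\<ge>N. L2_dist M (A m) (A n) < e" if "e > 0" for e
        using G_Cauchy[OF that] dist_le(1) by (meson le_less_trans)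
    qed
    obtain B' where B': "B' \<in> L2 M" "(\<lambda>k. L2_dist M (B k) B') \<longlonglongrightarrow> 0"
    proof (rule L2_complete[of B, OF B])
      show "\<exists>N. \<forall>m\<ge>N. \<forall>n\<ge>N. L2_dist M (B m) (B n) < e" if "e > 0" for e
        using G_Cauchy[OF that] dist_le(2) by (meson le_less_trans)
    qed
    have "L2_dist M (?G k) (combine A' B') = sqrt ((L2_dist M (A k) A')\<^sup>2 + (L2_dist M (B k) B')\<^sup>2)" for k
      using combine_dist[OF A B A'(1) B'(1), of k k] by (metis L2_dist_nonneg real_sqrt_unique)
    then have "(\<lambda>k. L2_dist M F (?G k) + L2_dist M (?G k) (combine A' B')) \<longlonglongrightarrow> 0"
      using tendsto_add[OF G_lim tendsto_real_sqrt[OF tendsto_add[OF tendsto_power[OF A'(2), of 2]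
        tendsto_power[OF B'(2), of 2]]]]
      by simp
    \<comment> \<open>The constant distance is bounded by a sequence tending to 0, through the
      triangle inequality at \<open>?G k\<close>.\<close>
    then have "L2_dist M F (combine A' B') \<le> 0"
      using L2_dist_triangle[OF F G, of "combine A' B'"] A' B' by (intro LIMSEQ_le_const) auto
    then have "F = combine A' B'"
      using F A' B' L2_dist_nonneg[of M F "combine A' B'"]
      by (intro L2_dist_eq_0D) (auto simp del: L2_dist_nonneg)
    then show "F \<in> V" using VI[OF A'(1) B'(1)] by simp
  qed
  then show thesis using assms that unfolding V_def by blast
qed

section \<open>Adjoints and the two Cuntz relations\<close>

lemma adjoint_S:
  assumes "i < 2" "j < 2" "F \<in> L2 M"
  shows "L2_adjoint M (S i) (S j F) = L2_scale M (if i = j then 1 else 0) F"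
  using assms by (intro L2_adjoint_eqI) (auto simp: S_inner L2_inner_simps)

lemma adjoint_combine:
  assumes "A \<in> L2 M" "B \<in> L2 M"
  shows "L2_adjoint M (S 0) (combine A B) = A" "L2_adjoint M (S 1) (combine A B) = B"
  using assms by (auto intro!: L2_adjoint_eqI simp: S_inner L2_inner_simps)

text \<open>By \<open>combine_surj\<close> F is S 0 A + S 1 B, and the two adjoints recover A and
  B.\<close>

lemma combine_adjoint:
  assumes "F \<in> L2 M"
  shows "combine (L2_adjoint M (S 0) F) (L2_adjoint M (S 1) F) = F"
  using assms by (metis combine_surj adjoint_combine)

end

subsection \<open>The canonical index set\<close>

text \<open>Prepends b as the lowest digit in base 2n; \<open>case_nat b a\<close> is the shifted
  digit sequence.\<close>

lemma canonical_index_set_shift: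
  assumes "g \<in> canonical_index_set n" "b \<in> {0, real n / 2}"
  shows "b + 2 * real n * g \<in> canonical_index_set n"
proof -
  obtain m a where a: "g = (\<Sum>i\<le>m. a i * (2 * real n) ^ i)" "\<forall>i\<le>m. a i \<in> {0, real n / 2}"
    using assms(1) by (auto simp: canonical_index_set_def)
  have "b + 2 * real n * g = (\<Sum>i\<le>Suc m. case_nat b a i * (2 * real n) ^ i)"
    unfolding sum.atMost_Suc_shift by (simp add: a(1) sum_distrib_left mult_ac)
  moreover have "\<forall>i\<le>Suc m. case_nat b a i \<in> {0, real n / 2}"
    using a(2) assms(2) by (auto split: nat.split)
  ultimately show ?thesis unfolding canonical_index_set_def by blast
qed

lemma zero_in_canonical_index_set: "0 \<in> canonical_index_set n"
  unfolding canonical_index_set_def by (auto intro!: exI[of _ 0] exI[of _ "\<lambda>_. 0"])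

text \<open>Splits off the lowest digit, inverting the shift. A single-digit element leaves the
  quotient 0, which is again in the set.\<close>

lemma canonical_index_set_cases:
  assumes "g \<in> canonical_index_set n"
  obtains b h where "b \<in> {0, real n / 2}" "h \<in> canonical_index_set n" "g = b + 2 * real n * h"
proof -
  obtain m a where a: "g = (\<Sum>i\<le>m. a i * (2 * real n) ^ i)" "\<forall>i\<le>m. a i \<in> {0, real n / 2}"
    using assms by (auto simp: canonical_index_set_def)
  show thesis
  proof (cases m)
    case 0
    then show thesis using a that[of "a 0" 0] zero_in_canonical_index_set by simp
  next
    case (Suc l)
    have "g = a 0 + 2 * real n * (\<Sum>i\<le>l. a (Suc i) * (2 * real n) ^ i)"
      unfolding a(1) Suc sum.atMost_Suc_shift by (simp add: sum_distrib_left mult_ac)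
    moreover have "(\<Sum>i\<le>l. a (Suc i) * (2 * real n) ^ i) \<in> canonical_index_set n"
      unfolding canonical_index_set_def using a(2) Suc
      by (intro CollectI exI[of _ l] exI[of _ "\<lambda>i. a (Suc i)"]) auto
    ultimately show thesis using a(2) that by blast
  qed
qed

text \<open>Factoring n/2 out of the digits leaves a sum of distinct powers of 2n; the integer
  factor makes parity available even when n is odd.\<close>

lemma canonical_index_set_multiple:
  assumes "g \<in> canonical_index_set n"
  obtains k :: nat where "g = real n / 2 * real k"
proof -
  obtain m a where a: "g = (\<Sum>i\<le>m. a i * (2 * real n) ^ i)" "\<forall>i\<le>m. a i \<in> {0, real n / 2}"
    using assms by (auto simp: canonical_index_set_def)
  have "g = (\<Sum>i\<le>m. real n / 2 * real (if a i = 0 then 0 else (2 * n) ^ i))"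
    unfolding a(1) using a(2) by (intro sum.cong) auto
  also have "\<dots> = real n / 2 * real (\<Sum>i\<le>m. if a i = 0 then 0 else (2 * n) ^ i)"
    by (simp only: sum_distrib_left of_nat_sum)
  finally show thesis by (rule that)
qed

text \<open>Dividing by n/2 turns an equality into 2nk = 1 + 2nl, contradicting parity.\<close>

lemma canonical_index_set_shifts_disjoint:
  assumes "n \<ge> 1" "g \<in> canonical_index_set n" "h \<in> canonical_index_set n"
  shows "2 * real n * g \<noteq> real n / 2 + 2 * real n * h"
proof
  assume eq: "2 * real n * g = real n / 2 + 2 * real n * h"
  obtain k l where kl: "g = real n / 2 * real k" "h = real n / 2 * real l"
    using assms(2,3) by (metis canonical_index_set_multiple)
  have "real n / 2 * real (2 * n * k) = real n / 2 * real (1 + 2 * n * l)"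
    using eq by (simp add: kl algebra_simps)
  then have "2 * n * k = 1 + 2 * n * l"
    using assms(1) by (simp only: mult_cancel_left of_nat_eq_iff) simp
  then have "even (1 + 2 * n * l)" by (metis dvd_triv_left mult.assoc)
  then show False by simp
qed

section \<open>The exponential basis as an instance of the splitting\<close>

theorem proposition3p2:
  fixes n :: nat
    and \<mu> :: "real measure"
    and S :: "nat \<Rightarrow> (real \<Rightarrow> complex) set \<Rightarrow> (real \<Rightarrow> complex) set"
  assumes "n \<ge> 1"
    and "bernoulli_convolution (1 / (2 * real n)) \<mu>"
    and "L2_orthonormal_basis \<mu> (canonical_index_set n) (expo \<mu>)"
    and "L2_bounded_linear \<mu> (S 0)"
    and "L2_bounded_linear \<mu> (S 1)"
    and "\<forall>\<gamma>\<in>canonical_index_set n. S 0 (expo \<mu> \<gamma>) = expo \<mu> (2 * real n * \<gamma>)"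
    and "\<forall>\<gamma>\<in>canonical_index_set n. S 1 (expo \<mu> \<gamma>) = expo \<mu> (real n / 2 + 2 * real n * \<gamma>)"
  shows "(\<forall>F\<in>L2 \<mu>. L2_add \<mu> (S 0 (L2_adjoint \<mu> (S 0) F)) (S 1 (L2_adjoint \<mu> (S 1) F)) = F) \<and>
    (\<forall>i\<in>{0, 1}. \<forall>j\<in>{0, 1}. \<forall>F\<in>L2 \<mu>.
       L2_adjoint \<mu> (S i) (S j F) = L2_scale \<mu> (if i = j then 1 else 0) F)"
proof -
  let ?\<Gamma> = "canonical_index_set n"
  define s where "s i \<gamma> = (if i = 0 then 0 else real n / 2) + 2 * real n * \<gamma>" for i :: nat and \<gamma>
  interpret L2_basis_splitting \<mu> ?\<Gamma> "expo \<mu>" S s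
  proof
    show "?\<Gamma> = s 0 ` ?\<Gamma> \<union> s 1 ` ?\<Gamma>"
    proof
      show "?\<Gamma> \<subseteq> s 0 ` ?\<Gamma> \<union> s 1 ` ?\<Gamma>"
      proof
        fix g assume "g \<in> ?\<Gamma>"
        then obtain b h where "b \<in> {0, real n / 2}" "h \<in> ?\<Gamma>" "g = b + 2 * real n * h"
          by (rule canonical_index_set_cases)
        then have "g = s 0 h \<or> g = s 1 h" by (auto simp: s_def)
        then show "g \<in> s 0 ` ?\<Gamma> \<union> s 1 ` ?\<Gamma>" using \<open>h \<in> ?\<Gamma>\<close> by blast
      qed
      show "s 0 ` ?\<Gamma> \<union> s 1 ` ?\<Gamma> \<subseteq> ?\<Gamma>"
        using canonical_index_set_shift[of _ n 0] canonical_index_set_shift[of _ n "real n / 2"]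
        by (auto simp: s_def)
    qed
    fix i j :: nat and k l :: real
    assume ij: "i < 2" "j < 2" and kl: "k \<in> ?\<Gamma>" "l \<in> ?\<Gamma>"
    \<comment> \<open>For i = j the digit and the factor 2n > 0 cancel; for i \<noteq> j
      disjointness applies, in either order.\<close>
    show "s i k = s j l \<longleftrightarrow> i = j \<and> k = l"
      using ij assms(1) canonical_index_set_shifts_disjoint[OF assms(1) kl]
        canonical_index_set_shifts_disjoint[OF assms(1) kl(2,1)]
      by (auto simp: s_def less_2_cases_iff)
  qed (use assms in \<open>auto simp: s_def less_2_cases_iff\<close>)
  show ?thesis
    using combine_adjoint adjoint_S by auto
qed

end
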